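(* Let $n\ge k\ge2$ be integers and let $\mathcal Y^{n,k}$ be the set of $\underline{x}\in\mathbb R^n$ for which there is a finite collection of $k$-dimensional sublattices $\mathcal L_1,\dots,\mathcal L_{i(\underline{x})}$ of $\mathbb Z^{n+1}$ (depending on $\underline{x}$) whose union contains infinitely many best approximations for $\underline{x}$. Then \[ \dim_H(\mathcal Y^{n,k})\le n-1+\frac{k}{n+1}. \]
   Context: Use the maximum norm. For $\underline{x}=(\xi_1,\dots,\xi_n)$ write $\underline{x}^*=(\xi_1,\dots,\xi_n,1)$ and for $\mathbf y\in\mathbb R^{n+1}$ let $\hat{\mathbf y}$ be its first $n$ coordinates. $\mathbf q\in\mathbb Z^{n+1}$ is a best approximation for $\underline{x}$ if $|\mathbf q\cdot\underline{x}^*|=\min\{|\mathbf b\cdot\underline{x}^*|:\mathbf b\in\mathbb Z^{n+1},0<\Vert\hat{\mathbf b}\Vert\le\Vert\hat{\mathbf q}\Vert\}$. $\dim_H$ is Hausdorff dimension. *)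

theory Defs
  imports "HOL-Analysis.Analysis"
begin

(* R^n is real ^ 'n with n = CARD('n), and R^(n+1) is (real ^ 'n) \<times> real, so that x^* is (x, 1),
   the hat of y is fst y, and the inner product of the product space is the usual dot product.
   The maximum norm is infnorm. *)

definition integer_points :: "((real ^ 'n) \<times> real) set" where
  "integer_points = {q. (\<forall>i. fst q $ i \<in> \<int>) \<and> snd q \<in> \<int>}"

(* The constraint 0 < infnorm (fst b), applied to b = q, excludes vectors q with fst q = 0,
   for which the minimum would range over the empty set. *)
definition best_approximation :: "real ^ 'n \<Rightarrow> (real ^ 'n) \<times> real \<Rightarrow> bool" where
  "best_approximation x q \<longleftrightarrow>
     is_arg_min (\<lambda>b. \<bar>b \<bullet> (x, 1)\<bar>)
       (\<lambda>b. b \<in> integer_points \<and> 0 < infnorm (fst b) \<and> infnorm (fst b) \<le> infnorm (fst q)) q"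

(* The rank of a subgroup of the integer points is the dimension of its real span,
   and dim L is the dimension of span L. *)
definition sublattice :: "nat \<Rightarrow> ((real ^ 'n) \<times> real) set \<Rightarrow> bool" where
  "sublattice k L \<longleftrightarrow>
     L \<subseteq> integer_points \<and> 0 \<in> L \<and> (\<forall>u\<in>L. \<forall>v\<in>L. u - v \<in> L) \<and> dim L = k"

definition Y_set :: "nat \<Rightarrow> (real ^ 'n) set" where
  "Y_set k = {x. \<exists>\<L>. finite \<L> \<and> (\<forall>L\<in>\<L>. sublattice k L) \<and>
                     infinite {q \<in> \<Union>\<L>. best_approximation x q}}"

(* Diameter to the power s, with the conventions 0 for the empty set and 0^0 = 1 otherwise
   (0 powr 0 = 0 in the library), so that the 0-dimensional measure is counting measure. *)
definition diameter_power :: "real \<Rightarrow> 'a::metric_space set \<Rightarrow> ennreal" where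
  "diameter_power s U =
     (if U = {} then 0 else if s = 0 then 1 else ennreal (diameter U powr s))"

(* Boundedness is required separately because diameter is meaningless on unbounded sets. *)
definition hausdorff_content :: "real \<Rightarrow> real \<Rightarrow> 'a::metric_space set \<Rightarrow> ennreal" where
  "hausdorff_content \<delta> s A =
     (INF U \<in> {U :: nat \<Rightarrow> 'a set. A \<subseteq> (\<Union>i. U i) \<and> (\<forall>i. bounded (U i) \<and> diameter (U i) \<le> \<delta>)}.
        (\<Sum>i. diameter_power s (U i)))"

definition hausdorff_measure :: "real \<Rightarrow> 'a::metric_space set \<Rightarrow> ennreal" where
  "hausdorff_measure s A = (SUP \<delta> \<in> {0<..}. hausdorff_content \<delta> s A)"

(* On real ^ 'n the underlying distance is Euclidean; the dimension is the same for the equivalent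
   maximum norm. *)
definition hausdorff_dim :: "'a::metric_space set \<Rightarrow> ereal" where
  "hausdorff_dim A = (INF s \<in> {s. 0 \<le> s \<and> hausdorff_measure s A = 0}. ereal s)"

end

theory Submission
  imports Defs
begin

text \<open>
  By the pigeonhole principle one sublattice contains infinitely many best approximations \<open>q\<close>
  for \<open>x\<close>, and its span is one of countably many rational subspaces \<open>V\<close>. Dirichlet's theorem
  puts \<open>x\<close> within distance of order \<open>Q\<^sup>-\<^sup>n\<^sup>-\<^sup>1\<close> from the hyperplane \<open>q \<bullet> x\<^sup>* = 0\<close>, where \<open>Q\<close> is
  the height of \<open>q\<close>. For \<open>Q\<close> of size \<open>2\<^sup>j\<close> there are \<open>O(2\<^sup>j\<^sup>k)\<close> such \<open>q\<close> in \<open>V\<close>, and the part of each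
  strip in a fixed box is covered by \<open>O(M\<^sup>n\<^sup>-\<^sup>1)\<close> sets of diameter \<open>O(1/M)\<close> with \<open>M = 2 ^ ((n+1) j)\<close>.
  The resulting sum over \<open>j\<close> of \<open>2 ^ (j (k + (n+1)(n-1) - (n+1) s))\<close> converges for
  \<open>s > n - 1 + k/(n+1)\<close>, so the limsup set is null (Borel--Cantelli).
\<close>

section \<open>Null sets of Hausdorff measures\<close>

text \<open>Doubly indexed covers fit both later uses: one cover per member of a countable union,
  and one finite family per level of a limsup set. Flattening by \<open>prod_decode\<close>
  preserves the sum because the terms are nonnegative.\<close>

lemma hausdorff_measure_eq_0I:
  fixes A :: "'a::metric_space set"
  assumes "\<And>\<delta> \<epsilon>. 0 < \<delta> \<Longrightarrow> 0 < \<epsilon> \<Longrightarrow> \<exists>U :: nat \<Rightarrow> nat \<Rightarrow> 'a set.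
      A \<subseteq> (\<Union>i j. U i j) \<and> (\<forall>i j. bounded (U i j) \<and> diameter (U i j) \<le> \<delta>) \<and>
      (\<Sum>i. \<Sum>j. diameter_power s (U i j)) \<le> ennreal \<epsilon>"
  shows "hausdorff_measure s A = 0"
proof -
  have "hausdorff_content \<delta> s A \<le> 0" if "\<delta> > 0" for \<delta>
  proof (rule ennreal_le_epsilon)
    fix \<epsilon> :: real
    assume "\<epsilon> > 0"
    then obtain U :: "nat \<Rightarrow> nat \<Rightarrow> 'a set" where U: "A \<subseteq> (\<Union>i j. U i j)"
      "\<And>i j. bounded (U i j)" "\<And>i j. diameter (U i j) \<le> \<delta>"
      "(\<Sum>i. \<Sum>j. diameter_power s (U i j)) \<le> ennreal \<epsilon>"
      using assms[OF \<open>\<delta> > 0\<close>] by metis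
    define W where "W = (\<lambda>p. U (fst p) (snd p)) \<circ> prod_decode"
    have "A \<subseteq> (\<Union>i. W i)"
    proof
      fix x assume "x \<in> A"
      then obtain i j where "x \<in> U i j" using U(1) by blast
      then have "x \<in> W (prod_encode (i, j))" by (simp add: W_def)
      then show "x \<in> (\<Union>i. W i)" by blast
    qed
    then have "hausdorff_content \<delta> s A \<le> (\<Sum>i. diameter_power s (W i))"
      unfolding hausdorff_content_def
      by (intro INF_lower) (auto simp: W_def U)
    also have "\<dots> = (\<Sum>i. (\<lambda>p. diameter_power s (U (fst p) (snd p))) (prod_decode i))"
      by (simp add: W_def)
    also have "\<dots> = (\<Sum>i. \<Sum>j. diameter_power s (U i j))"
      by (rule suminf_ennreal_2dimen) simp
    finally show "hausdorff_content \<delta> s A \<le> 0 + ennreal \<epsilon>"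
      using U(4) by simp
  qed
  then show ?thesis
    unfolding hausdorff_measure_def by (intro antisym SUP_least) auto
qed

text \<open>Each \<open>A i\<close> gets the budget \<open>\<epsilon> * (1/2) ^ Suc i\<close>, and
  these budgets sum to \<epsilon>.\<close>

lemma hausdorff_measure_UN_null:
  fixes A :: "nat \<Rightarrow> 'a::metric_space set"
  assumes null: "\<And>i. hausdorff_measure s (A i) = 0"
  shows "hausdorff_measure s (\<Union>i. A i) = 0"
proof (rule hausdorff_measure_eq_0I)
  fix \<delta> \<epsilon> :: real
  assume "\<delta> > 0" "\<epsilon> > 0"
  have "\<exists>U :: nat \<Rightarrow> 'a set. A i \<subseteq> (\<Union>j. U j) \<and> (\<forall>j. bounded (U j) \<and> diameter (U j) \<le> \<delta>) \<and>
      (\<Sum>j. diameter_power s (U j)) < ennreal (\<epsilon> * (1/2) ^ Suc i)" for i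
  proof -
    have "hausdorff_content \<delta> s (A i) \<le> hausdorff_measure s (A i)"
      unfolding hausdorff_measure_def using \<open>\<delta> > 0\<close> by (intro SUP_upper) auto
    also have "\<dots> < ennreal (\<epsilon> * (1/2) ^ Suc i)"
      using null \<open>\<epsilon> > 0\<close> by (simp add: ennreal_less_zero_iff)
    finally show ?thesis
      unfolding hausdorff_content_def INF_less_iff by blast
  qed
  then obtain U :: "nat \<Rightarrow> nat \<Rightarrow> 'a set" where U: "\<And>i. A i \<subseteq> (\<Union>j. U i j)"
    "\<And>i j. bounded (U i j)" "\<And>i j. diameter (U i j) \<le> \<delta>"
    "\<And>i. (\<Sum>j. diameter_power s (U i j)) < ennreal (\<epsilon> * (1/2) ^ Suc i)"
    by metis
  have "(\<Sum>i. \<Sum>j. diameter_power s (U i j)) \<le> (\<Sum>i. ennreal (\<epsilon> * (1/2) ^ Suc i))"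
    using U(4) by (intro suminf_le) (auto simp: less_imp_le)
  also have "\<dots> = ennreal \<epsilon>"
    using sums_mult[OF power_half_series, of \<epsilon>] \<open>\<epsilon> > 0\<close>
    by (subst suminf_ennreal_eq) auto
  finally show "\<exists>U :: nat \<Rightarrow> nat \<Rightarrow> 'a set. (\<Union>i. A i) \<subseteq> (\<Union>i j. U i j) \<and>
      (\<forall>i j. bounded (U i j) \<and> diameter (U i j) \<le> \<delta>) \<and>
      (\<Sum>i. \<Sum>j. diameter_power s (U i j)) \<le> ennreal \<epsilon>"
    using U(1-3) by (intro exI[of _ U] conjI UN_mono) auto
qed

lemma hausdorff_measure_mono:
  "A \<subseteq> B \<Longrightarrow> hausdorff_measure s A \<le> hausdorff_measure s B"
  unfolding hausdorff_measure_def hausdorff_content_def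
  by (intro SUP_mono' INF_superset_mono) auto

text \<open>The enumeration \<open>from_nat_into\<close> may repeat indices, which is harmless in a
  union, but it enumerates \<open>I\<close> only if \<open>I\<close> is nonempty; hence the case
  split.\<close>

lemma hausdorff_measure_countable_UN_null:
  fixes A :: "'i \<Rightarrow> 'a::metric_space set"
  assumes "countable I" and null: "\<And>i. i \<in> I \<Longrightarrow> hausdorff_measure s (A i) = 0"
  shows "hausdorff_measure s (\<Union>i\<in>I. A i) = 0"
proof -
  have empty: "hausdorff_measure s ({} :: 'a set) = 0"
    by (rule hausdorff_measure_eq_0I, rule exI[of _ "\<lambda>_ _. {}"])
      (auto simp: diameter_power_def diameter_def)
  show ?thesis
  proof (cases "I = {}")
    case False
    have "hausdorff_measure s (\<Union>i. A (from_nat_into I i)) = 0"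
      using from_nat_into[OF False] null by (intro hausdorff_measure_UN_null) auto
    moreover have "(\<Union>i. A (from_nat_into I i)) = (\<Union>i\<in>I. A i)"
      using range_from_nat_into[OF False \<open>countable I\<close>] by (metis image_image)
    ultimately show ?thesis by simp
  qed (use empty in simp)
qed

section \<open>Borel-Cantelli for Hausdorff measure\<close>

lemma diameter_power_le:
  assumes "s > 0" "bounded U" "diameter U \<le> d"
  shows "diameter_power s U \<le> ennreal (d powr s)"
  \<comment> \<open>With \<open>s > 0\<close> a set of diameter 0 has power 0; for
    \<open>s = 0\<close> it would have power 1 if nonempty, while \<open>0 powr 0\<close> is
    0.\<close>
  using assms diameter_ge_0[of U]
  by (auto simp: diameter_power_def intro!: ennreal_leI powr_mono2)

text \<open>Level \<open>i\<close> costs at most \<open>C * N ^ i * (D * \<rho> ^ i) powr s\<close>,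
  a geometric sequence of ratio \<open>N * \<rho> powr s\<close>. A point lying in infinitely many
  levels is covered by every tail, and the tails of a convergent series tend to 0.\<close>

lemma hausdorff_measure_limsup_null:
  fixes A :: "'a::metric_space set" and F :: "nat \<Rightarrow> 'a set set"
  assumes fin: "\<And>i. finite (F i)"
    and card: "\<And>i. real (card (F i)) \<le> C * N ^ i"
    and bdd: "\<And>i U. U \<in> F i \<Longrightarrow> bounded U"
    and diam: "\<And>i U. U \<in> F i \<Longrightarrow> diameter U \<le> D * \<rho> ^ i"
    and limsup: "\<And>x. x \<in> A \<Longrightarrow> infinite {i. x \<in> \<Union> (F i)}"
    and pos: "s > 0" "0 < \<rho>" "\<rho> < 1" "D \<ge> 0" "N \<ge> 0"
    and geom: "N * \<rho> powr s < 1"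
  shows "hausdorff_measure s A = 0"
proof (rule hausdorff_measure_eq_0I)
  fix \<delta> \<epsilon> :: real
  assume "\<delta> > 0" "\<epsilon> > 0"
  define c where "c = N * \<rho> powr s"
  have c: "0 \<le> c" "c < 1" using geom pos by (auto simp: c_def)
  define K where "K = C * D powr s"
  have "0 \<le> C" using card[of 0] by simp
  then have "0 \<le> K" by (simp add: K_def)
  \<comment> \<open>The first sequence bounds the diameters at level \<open>i\<close>, the second is
    the tail of the cost series from level \<open>i\<close> on; both must be small at the starting
    level \<open>J\<close>.\<close>
  have "(\<lambda>i. D * \<rho> ^ i) \<longlonglongrightarrow> D * 0" "(\<lambda>i. K / (1 - c) * c ^ i) \<longlonglongrightarrow> K / (1 - c) * 0"
    using pos c by (intro tendsto_mult tendsto_const LIMSEQ_power_zero; simp)+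
  then have "eventually (\<lambda>i. D * \<rho> ^ i < \<delta> \<and> K / (1 - c) * c ^ i < \<epsilon>) sequentially"
    using \<open>\<delta> > 0\<close> \<open>\<epsilon> > 0\<close> by (intro eventually_conj) (auto elim: order_tendstoD)
  then obtain J where J: "D * \<rho> ^ J < \<delta>" "K / (1 - c) * c ^ J < \<epsilon>"
    by (auto simp: eventually_sequentially)
  obtain e where e: "\<And>i. bij_betw (e i) {0..<card (F i)} (F i)"
    using ex_bij_betw_nat_finite[OF fin] by metis
  \<comment> \<open>Each finite family is padded to a sequence by empty sets, to which
    \<open>diameter_power\<close> assigns 0.\<close>
  define U where "U = (\<lambda>i j. if j < card (F (J + i)) then e (J + i) j else {})"
  have eF: "e i j \<in> F i" if "j < card (F i)" for i j
    using e[of i] that by (auto simp: bij_betw_def)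
  have U_bdd: "bounded (U i j)" for i j
    using bdd eF by (auto simp: U_def)
  have U_diam: "diameter (U i j) \<le> D * \<rho> ^ (J + i)" for i j
    using diam eF pos by (auto simp: U_def diameter_def[of "{}"])
  have "diameter (U i j) \<le> \<delta>" for i j
  proof -
    have "D * \<rho> ^ (J + i) \<le> D * \<rho> ^ J"
      using pos by (intro mult_left_mono power_decreasing) auto
    then show ?thesis using U_diam[of i j] J by linarith
  qed
  moreover have "A \<subseteq> (\<Union>i j. U i j)"
  proof
    fix x assume "x \<in> A"
    then obtain i where i: "i \<ge> J" "x \<in> \<Union> (F i)"
      using limsup[OF \<open>x \<in> A\<close>] unfolding infinite_nat_iff_unbounded_le by blast
    then obtain W where W: "W \<in> F i" "x \<in> W" by blast
    then have "W \<in> e i ` {0..<card (F i)}" using bij_betw_imp_surj_on[OF e] by simp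
    then obtain j where "j < card (F i)" "W = e i j" by auto
    then have "x \<in> U (i - J) j" using i W by (simp add: U_def)
    then show "x \<in> (\<Union>i j. U i j)" by blast
  qed
  moreover have "(\<Sum>i. \<Sum>j. diameter_power s (U i j)) \<le> ennreal \<epsilon>"
  proof -
    have "(\<Sum>j. diameter_power s (U i j)) \<le> ennreal (K * c ^ (J + i))" for i
    proof -
      let ?m = "card (F (J + i))"
      have "(\<Sum>j. diameter_power s (U i j)) = (\<Sum>j<?m. diameter_power s (U i j))"
        by (rule suminf_finite) (auto simp: U_def diameter_power_def)
      also have "\<dots> \<le> (\<Sum>j<?m. ennreal ((D * \<rho> ^ (J + i)) powr s))"
        by (intro sum_mono diameter_power_le pos U_bdd U_diam)
      also have "\<dots> = ennreal (real ?m * (D * \<rho> ^ (J + i)) powr s)"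
        by (simp add: ennreal_mult ennreal_of_nat_eq_real_of_nat)
      also have "\<dots> \<le> ennreal (C * N ^ (J + i) * (D * \<rho> ^ (J + i)) powr s)"
        by (intro ennreal_leI mult_right_mono card) auto
      also have "(D * \<rho> ^ (J + i)) powr s = D powr s * (\<rho> powr s) ^ (J + i)"
        using pos by (simp add: powr_mult powr_powr mult.commute flip: powr_realpow)
      finally show ?thesis by (simp add: K_def c_def power_mult_distrib mult_ac)
    qed
    then have "(\<Sum>i. \<Sum>j. diameter_power s (U i j)) \<le> (\<Sum>i. ennreal (K * c ^ (J + i)))"
      by (intro suminf_le) auto
    also have "\<dots> = ennreal (K / (1 - c) * c ^ J)"
      using sums_mult[OF geometric_sums[of c], of "K * c ^ J"] c \<open>0 \<le> K\<close>
      by (intro suminf_ennreal_eq) (auto simp: power_add mult_ac)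
    finally show ?thesis using J by (meson ennreal_leI less_imp_le order_trans)
  qed
  ultimately show "\<exists>U :: nat \<Rightarrow> nat \<Rightarrow> 'a set. A \<subseteq> (\<Union>i j. U i j) \<and>
      (\<forall>i j. bounded (U i j) \<and> diameter (U i j) \<le> \<delta>) \<and>
      (\<Sum>i. \<Sum>j. diameter_power s (U i j)) \<le> ennreal \<epsilon>"
    using U_bdd by (intro exI[of _ U]) simp
qed

section \<open>Integer points\<close>

lemma infnorm_attained:
  fixes x :: "real ^ 'n::finite"
  obtains i where "infnorm x = \<bar>x $ i\<bar>"
proof -
  have "infnorm x = Max (range (\<lambda>i. \<bar>x $ i\<bar>))"
    unfolding infnorm_cart by (subst cSup_eq_Max) (auto simp: full_SetCompr_eq)
  moreover have "Max (range (\<lambda>i. \<bar>x $ i\<bar>)) \<in> range (\<lambda>i. \<bar>x $ i\<bar>)"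
    by (intro Max_in) auto
  ultimately show ?thesis using that by (metis imageE)
qed

text \<open>Heights are natural numbers, so Dirichlet's theorem can be applied with the height of a
  best approximation as its parameter.\<close>

lemma infnorm_integer_point:
  fixes q :: "(real ^ 'n::finite) \<times> real"
  assumes "q \<in> integer_points"
  obtains Q :: nat where "infnorm (fst q) = real Q"
proof -
  obtain i where i: "infnorm (fst q) = \<bar>fst q $ i\<bar>" by (rule infnorm_attained)
  have "\<bar>fst q $ i\<bar> \<in> \<int>" using assms by (auto simp: integer_points_def)
  then show ?thesis using that i
    by (metis Ints_cases abs_of_nonneg abs_ge_zero of_int_0_le_iff of_int_of_nat_eq zero_le_imp_eq_int)
qed

lemma countable_integer_points: "countable (integer_points :: ((real ^ 'n::finite) \<times> real) set)"
proof -
  have "countable (PiE (UNIV :: 'n set) (\<lambda>_. \<int> :: real set))"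
    by (intro countable_PiE) (auto simp: Ints_def)
  then have "countable (vec_lambda ` PiE (UNIV :: 'n set) (\<lambda>_. \<int> :: real set) \<times> (\<int> :: real set))"
    by (intro countable_SIGMA) (auto simp: Ints_def)
  moreover have "q \<in> vec_lambda ` PiE UNIV (\<lambda>_. \<int>) \<times> \<int>" if "q \<in> integer_points"
    for q :: "(real ^ 'n) \<times> real"
    using that by (auto simp: integer_points_def mem_Times_iff intro!: image_eqI[of _ _ "vec_nth (fst q)"])
  ultimately show ?thesis by (meson countable_subset subsetI)
qed

section \<open>Counting integer points in a subspace\<close>

lemma integer_points_diff:
  "p \<in> integer_points \<Longrightarrow> q \<in> integer_points \<Longrightarrow> p - q \<in> integer_points"
  by (auto simp: integer_points_def)

text \<open>This separation makes the rounding of coordinates injective on integer points in the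
  count below.\<close>

lemma norm_integer_point_ge_1:
  fixes q :: "(real ^ 'n::finite) \<times> real"
  assumes "q \<in> integer_points" "q \<noteq> 0"
  shows "1 \<le> norm q"
proof -
  have *: "1 \<le> \<bar>z\<bar>" if "z \<in> \<int>" "z \<noteq> 0" for z :: real
    using that by (auto elim!: Ints_cases)
  show ?thesis
  proof (cases "snd q = 0")
    case True
    then obtain i where "fst q $ i \<noteq> 0" using assms by (auto simp: prod_eq_iff vec_eq_iff)
    then have "1 \<le> \<bar>fst q $ i\<bar>" using assms by (intro *) (auto simp: integer_points_def)
    also have "\<dots> \<le> norm (fst q)" by (rule component_le_norm_cart)
    also have "\<dots> \<le> norm q" by (metis norm_fst_le prod.collapse)
    finally show ?thesis .
  next
    case False
    then have "1 \<le> norm (snd q)" using assms by (simp, intro *) (auto simp: integer_points_def)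
    also have "\<dots> \<le> norm q" by (metis norm_snd_le prod.collapse)
    finally show ?thesis .
  qed
qed

text \<open>The exponent is the dimension of \<open>V\<close>, not of the ambient space; this is
  where the \<open>k\<close> of the final bound arises. The constant depends on \<open>k\<close>
  alone, since the separation of integer points is the same in every subspace.\<close>

lemma card_integer_points_subspace:
  fixes V :: "((real ^ 'n::finite) \<times> real) set" and R :: real
  assumes V: "subspace V" "dim V = k" and R: "R \<ge> 1"
  shows "finite {q \<in> V \<inter> integer_points. norm q \<le> R}" (is "finite ?S")
    and "real (card {q \<in> V \<inter> integer_points. norm q \<le> R}) \<le> ((2 * real k + 3) * R) ^ k"
proof -
  obtain B where B: "B \<subseteq> V" "pairwise orthogonal B" "\<And>x. x \<in> B \<Longrightarrow> norm x = 1"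
    "independent B" "card B = dim V" "span B = V"
    using orthonormal_basis_subspace[OF V(1)] by metis
  have finB: "finite B" using B(4) by (rule independent_imp_finite)
  \<comment> \<open>Coordinates in an orthonormal basis, rounded to multiples of \<open>1/k\<close>, determine a point of
    \<open>V\<close> up to an error less than 1, hence determine an integer point.\<close>
  define h where "h = (\<lambda>q. restrict (\<lambda>b. \<lfloor>real k * (q \<bullet> b)\<rfloor>) B)"
  define T where "T = \<lceil>real k * R\<rceil>"
  have expand: "v = (\<Sum>b\<in>B. (v \<bullet> b) *\<^sub>R b)" if "v \<in> V" for v
    using orthonormal_basis_expand[of B v] B that finB by simp
  have "inj_on h ?S"
  proof (rule inj_onI, rule ccontr)
    fix p q assume pq: "p \<in> ?S" "q \<in> ?S" "h p = h q" "p \<noteq> q"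
    then have "p - q \<in> V" using V by (auto intro: subspace_diff)
    have "1 \<le> norm (p - q)"
      using pq by (intro norm_integer_point_ge_1 integer_points_diff) auto
    have small: "real k * \<bar>(p - q) \<bullet> b\<bar> < 1" if "b \<in> B" for b
    proof -
      have "\<lfloor>real k * (p \<bullet> b)\<rfloor> = \<lfloor>real k * (q \<bullet> b)\<rfloor>"
        using fun_cong[OF pq(3), of b] that by (simp add: h_def)
      then have "\<bar>real k * (p \<bullet> b) - real k * (q \<bullet> b)\<bar> < 1" by linarith
      moreover have "real k * (p \<bullet> b) - real k * (q \<bullet> b) = real k * ((p - q) \<bullet> b)"
        by (simp add: inner_diff_left algebra_simps)
      ultimately show ?thesis by (simp add: abs_mult)
    qed
    \<comment> \<open>In the trivial subspace \<open>p = q\<close> at once; excluding it gives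
      \<open>k > 0\<close>, so that division by \<open>k\<close> is legitimate.\<close>
    have "B \<noteq> {}"
    proof
      assume "B = {}"
      then have "p - q = 0" using expand[OF \<open>p - q \<in> V\<close>] by simp
      then show False using pq by simp
    qed
    then have "k > 0" using B V finB by (metis card_gt_0_iff)
    have "norm (p - q) = norm (\<Sum>b\<in>B. ((p - q) \<bullet> b) *\<^sub>R b)"
      using expand[OF \<open>p - q \<in> V\<close>] by simp
    also have "\<dots> \<le> (\<Sum>b\<in>B. \<bar>(p - q) \<bullet> b\<bar>)"
      by (rule order_trans[OF norm_sum]) (simp add: B)
    \<comment> \<open>There are \<open>k\<close> coordinates, each smaller than
      \<open>1 / k\<close>; this is why the rounding uses multiples of \<open>1 / k\<close>.\<close>
    also have "\<dots> < (\<Sum>b\<in>B. 1 / real k)"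
      using small \<open>k > 0\<close> by (intro sum_strict_mono finB \<open>B \<noteq> {}\<close>) (auto simp: field_simps)
    also have "\<dots> = 1" using B V \<open>k > 0\<close> by simp
    finally show False using \<open>1 \<le> norm (p - q)\<close> by simp
  qed
  moreover have "h ` ?S \<subseteq> PiE B (\<lambda>_. {-T..T})"
  proof (intro image_subsetI)
    fix q assume q: "q \<in> ?S"
    have "\<lfloor>real k * (q \<bullet> b)\<rfloor> \<in> {-T..T}" if "b \<in> B" for b
    proof -
      have "\<bar>q \<bullet> b\<bar> \<le> R"
        using Cauchy_Schwarz_ineq2[of q b] B(3)[OF that] q by simp
      then have "\<bar>real k * (q \<bullet> b)\<bar> \<le> real k * R"
        by (simp add: abs_mult mult_left_mono)
      then show ?thesis unfolding T_def by (simp add: le_floor_iff floor_le_iff) linarith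
    qed
    then show "h q \<in> PiE B (\<lambda>_. {-T..T})" by (auto simp: h_def)
  qed
  moreover have fin: "finite (PiE B (\<lambda>_. {-T..T}))" by (intro finite_PiE finB) auto
  ultimately show "finite ?S" by (meson inj_on_finite)
  have "card ?S \<le> card (PiE B (\<lambda>_. {-T..T}))"
    using \<open>inj_on h ?S\<close> \<open>h ` ?S \<subseteq> _\<close> fin by (rule card_inj_on_le)
  also have "\<dots> = nat (2 * T + 1) ^ k"
    using B V by (simp add: card_PiE finB)
  finally have "real (card ?S) \<le> real (nat (2 * T + 1) ^ k)"
    by (simp only: of_nat_le_iff)
  also have "\<dots> = real (nat (2 * T + 1)) ^ k" by (rule of_nat_power)
  also have "\<dots> \<le> ((2 * real k + 3) * R) ^ k"
  proof (rule power_mono)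
    have "0 \<le> real k * R" using R by simp
    then have "T \<ge> 0" "real_of_int T \<le> real k * R + 1" unfolding T_def by linarith+
    then have "real (nat (2 * T + 1)) \<le> 2 * (real k * R) + 3" by simp
    also have "\<dots> \<le> (2 * real k + 3) * R" using R by (simp add: algebra_simps)
    finally show "real (nat (2 * T + 1)) \<le> (2 * real k + 3) * R" .
  qed simp
  finally show "real (card ?S) \<le> ((2 * real k + 3) * R) ^ k" .
qed

section \<open>Best approximations\<close>

text \<open>Pigeonhole: the \<open>(Q + 1) ^ n\<close> coefficient vectors with entries in
  \<open>{0..Q}\<close> outnumber the \<open>Q ^ n\<close> intervals of length
  \<open>1 / Q ^ n\<close> into which the fractional parts of the linear form fall. The difference
  of two vectors sharing an interval is the witness.\<close>

lemma dirichlet_linear_form: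
  fixes x :: "real ^ 'n::finite"
  assumes "Q \<ge> (1::nat)"
  obtains b where "b \<in> integer_points" "0 < infnorm (fst b)" "infnorm (fst b) \<le> real Q"
    "\<bar>b \<bullet> (x, 1)\<bar> \<le> 1 / real Q ^ CARD('n)"
proof -
  let ?n = "CARD('n)"
  define D where "D = PiE (UNIV :: 'n set) (\<lambda>_. {0..Q})"
  define l where "l = (\<lambda>f. \<Sum>i\<in>UNIV. real (f i) * x $ i)"
  define g where "g = (\<lambda>f. \<lfloor>real Q ^ ?n * frac (l f)\<rfloor>)"
  have Qn: "real Q ^ ?n > 0" using assms by simp
  have "card D = (Q + 1) ^ ?n" by (simp add: D_def card_PiE)
  moreover have "g f \<in> {0..<int (Q ^ ?n)}" for f
  proof -
    have "real Q ^ ?n * frac (l f) < real Q ^ ?n * 1"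
      using Qn frac_lt_1 by (intro mult_strict_left_mono) auto
    then show ?thesis unfolding g_def by (simp add: floor_less_iff)
  qed
  then have "card (g ` D) \<le> card {0..<int (Q ^ ?n)}"
    by (intro card_mono) auto
  moreover have "card {0..<int (Q ^ ?n)} = Q ^ ?n" by (simp del: of_nat_power)
  moreover have "Q ^ ?n < (Q + 1) ^ ?n" by (intro power_strict_mono) auto
  ultimately have "card (g ` D) < card D" by simp
  then have "\<not> inj_on g D" using card_image by force
  then obtain f f' where f: "f \<in> D" "f' \<in> D" "f \<noteq> f'" "g f = g f'"
    by (auto simp: inj_on_def)
  \<comment> \<open>The last coordinate cancels the integer parts, so that
    \<open>b \<bullet> (x, 1)\<close> is a difference of fractional parts.\<close>
  define b :: "(real ^ 'n) \<times> real"
    where "b = (\<chi> i. real (f i) - real (f' i), of_int (\<lfloor>l f'\<rfloor> - \<lfloor>l f\<rfloor>))"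
  have "b \<in> integer_points" by (auto simp: b_def integer_points_def)
  moreover have "0 < infnorm (fst b)"
    using f(3) by (auto simp: b_def infnorm_pos_lt vec_eq_iff fun_eq_iff)
  moreover have "infnorm (fst b) \<le> real Q"
  proof -
    obtain i where i: "infnorm (fst b) = \<bar>fst b $ i\<bar>" by (rule infnorm_attained)
    have "f i \<le> Q" "f' i \<le> Q" using f by (auto simp: D_def PiE_iff)
    then show ?thesis unfolding i by (simp add: b_def abs_if)
  qed
  moreover have "\<bar>b \<bullet> (x, 1)\<bar> \<le> 1 / real Q ^ ?n"
  proof -
    have "b \<bullet> (x, 1) = frac (l f) - frac (l f')"
      by (simp add: b_def inner_vec_def l_def frac_def sum_subtractf left_diff_distrib)
    moreover have "\<bar>real Q ^ ?n * frac (l f) - real Q ^ ?n * frac (l f')\<bar> < 1"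
      using f(4) unfolding g_def by linarith
    moreover have "real Q ^ ?n * frac (l f) - real Q ^ ?n * frac (l f')
        = real Q ^ ?n * (frac (l f) - frac (l f'))"
      by (simp add: algebra_simps)
    ultimately have "real Q ^ ?n * \<bar>b \<bullet> (x, 1)\<bar> < 1" using Qn by (simp add: abs_mult)
    then show ?thesis using Qn by (simp add: pos_le_divide_eq mult.commute)
  qed
  ultimately show ?thesis by (rule that)
qed

text \<open>Dirichlet's vector for \<open>Q\<close> equal to the height of \<open>q\<close> is a
  competitor in the minimum that \<open>q\<close> attains.\<close>

lemma best_approximation_bound:
  fixes x :: "real ^ 'n::finite"
  assumes "best_approximation x q"
  shows "q \<in> integer_points" "1 \<le> infnorm (fst q)"
    "\<bar>q \<bullet> (x, 1)\<bar> \<le> 1 / infnorm (fst q) ^ CARD('n)"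
proof -
  show q: "q \<in> integer_points"
    using assms by (auto simp: best_approximation_def is_arg_min_def)
  obtain Q where Q: "infnorm (fst q) = real Q" by (rule infnorm_integer_point[OF q])
  have "0 < infnorm (fst q)"
    using assms by (auto simp: best_approximation_def is_arg_min_def)
  then have "1 \<le> Q" using Q by simp
  then show "1 \<le> infnorm (fst q)" using Q by simp
  obtain b where b: "b \<in> integer_points" "0 < infnorm (fst b)" "infnorm (fst b) \<le> real Q"
    "\<bar>b \<bullet> (x, 1)\<bar> \<le> 1 / real Q ^ CARD('n)"
    by (rule dirichlet_linear_form[OF \<open>1 \<le> Q\<close>])
  then have "\<bar>q \<bullet> (x, 1)\<bar> \<le> \<bar>b \<bullet> (x, 1)\<bar>"
    using assms Q unfolding best_approximation_def is_arg_min_linorder by metis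
  then show "\<bar>q \<bullet> (x, 1)\<bar> \<le> 1 / infnorm (fst q) ^ CARD('n)" using b Q by simp
qed

section \<open>Covering the strip around a rational hyperplane\<close>

text \<open>By \<open>w * real M \<le> infnorm (fst q)\<close> the strip, measured along the axis of
  a dominant coordinate of \<open>q\<close>, has half-width at most the mesh \<open>1 / M\<close>.
  It is therefore covered as cheaply as a piece of a hyperplane, with exponent
  \<open>n - 1\<close>.\<close>

lemma strip_cover:
  fixes q :: "(real ^ 'n::finite) \<times> real" and m M :: nat and w :: real
  assumes M: "M \<ge> 1" and q: "0 < infnorm (fst q)" and w: "w * real M \<le> infnorm (fst q)"
  shows "\<exists>F. finite F \<and> real (card F) \<le> (real (2 * m + 1) * real M) ^ (CARD('n) - 1) \<and>
      {x. infnorm x \<le> real m \<and> \<bar>q \<bullet> (x, 1)\<bar> \<le> w} \<subseteq> \<Union>F \<and>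
      (\<forall>U\<in>F. bounded U \<and> diameter U \<le> real CARD('n) * (real CARD('n) + 2) / real M)"
proof -
  let ?n = "CARD('n)"
  let ?strip = "{x. infnorm x \<le> real m \<and> \<bar>q \<bullet> (x, 1)\<bar> \<le> w}"
  obtain i where i: "infnorm (fst q) = \<bar>fst q $ i\<bar>" by (rule infnorm_attained)
  \<comment> \<open>Only the coordinates other than a dominant one of \<open>q\<close> need a grid: the strip then confines
    the dominant coordinate.\<close>
  define c where "c = (\<lambda>x :: real ^ 'n. restrict (\<lambda>l. \<lfloor>real M * x $ l\<rfloor>) (UNIV - {i}))"
  define G where "G = PiE (UNIV - {i}) (\<lambda>_. {- int (m * M)..int (m * M)})"
  define cell where "cell = (\<lambda>g. {x \<in> ?strip. c x = g})"
  have "finite G" unfolding G_def by (intro finite_PiE) auto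
  have "card G = (2 * m * M + 1) ^ (?n - 1)"
    by (simp add: G_def card_PiE card_Diff_singleton nat_add_distrib nat_mult_distrib mult_ac)
  moreover have "2 * m * M + 1 \<le> (2 * m + 1) * M" using M by (simp add: algebra_simps)
  ultimately have "card G \<le> ((2 * m + 1) * M) ^ (?n - 1)" by (metis power_mono zero_le)
  then have "card (cell ` G) \<le> ((2 * m + 1) * M) ^ (?n - 1)"
    using card_image_le[OF \<open>finite G\<close>, of cell] by linarith
  then have "real (card (cell ` G)) \<le> real (((2 * m + 1) * M) ^ (?n - 1))"
    by (simp only: of_nat_le_iff)
  also have "\<dots> = (real (2 * m + 1) * real M) ^ (?n - 1)" by (simp only: of_nat_power of_nat_mult)
  finally have card: "real (card (cell ` G)) \<le> (real (2 * m + 1) * real M) ^ (?n - 1)" .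
  have "?strip \<subseteq> \<Union>(cell ` G)"
  proof
    fix x assume x: "x \<in> ?strip"
    have "\<lfloor>real M * x $ l\<rfloor> \<in> {- int (m * M)..int (m * M)}" for l
    proof -
      have "\<bar>x $ l\<bar> \<le> real m" using x component_le_infnorm_cart[of x l] by simp
      then have "\<bar>real M * x $ l\<bar> \<le> real M * real m" by (simp add: abs_mult mult_left_mono)
      then have bounds: "- real (m * M) \<le> real M * x $ l" "real M * x $ l \<le> real (m * M)"
        by (auto simp: abs_le_iff mult_ac)
      have "- int (m * M) \<le> \<lfloor>real M * x $ l\<rfloor>"
        using bounds(1) by (simp add: le_floor_iff)
      moreover have "\<lfloor>real M * x $ l\<rfloor> \<le> int (m * M)"
        using floor_mono[OF bounds(2)] by (simp only: floor_of_nat)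
      ultimately show ?thesis by simp
    qed
    then have "c x \<in> G" by (auto simp: c_def G_def)
    then show "x \<in> \<Union>(cell ` G)" using x by (auto simp: cell_def)
  qed
  moreover have "bounded U \<and> diameter U \<le> real ?n * (real ?n + 2) / real M"
    if "U \<in> cell ` G" for U
  proof
    have dist: "norm (x - y) \<le> real ?n * (real ?n + 2) / real M" if "x \<in> U" "y \<in> U" for x y
    proof -
      have xy: "\<bar>q \<bullet> (x, 1)\<bar> \<le> w" "\<bar>q \<bullet> (y, 1)\<bar> \<le> w" "c x = c y"
        using that \<open>U \<in> cell ` G\<close> by (auto simp: cell_def)
      define z where "z = x - y"
      have other: "\<bar>z $ l\<bar> \<le> 1 / real M" if "l \<noteq> i" for l
      proof -
        have "\<lfloor>real M * x $ l\<rfloor> = \<lfloor>real M * y $ l\<rfloor>"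
          using fun_cong[OF xy(3), of l] that by (simp add: c_def)
        then have "\<bar>real M * x $ l - real M * y $ l\<bar> < 1" by linarith
        moreover have "real M * x $ l - real M * y $ l = real M * z $ l"
          by (simp add: z_def algebra_simps)
        ultimately show ?thesis using M by (simp add: abs_mult field_simps)
      qed
      \<comment> \<open>Solve \<open>fst q \<bullet> z\<close> for its dominant term. The product is
        a difference of two values of the form, so at most \<open>2 * w\<close>, which is at most
        \<open>2 / M\<close> times the dominant entry. Each other term is at most
        \<open>1 / M\<close> times that entry, and there are fewer than \<open>n\<close> of them;
        hence \<open>n + 2\<close>.\<close>
      have zi: "\<bar>z $ i\<bar> \<le> (real ?n + 2) / real M"
      proof -
        have "fst q \<bullet> z = (\<Sum>l\<in>UNIV. fst q $ l * z $ l)" by (simp add: inner_vec_def)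
        also have "\<dots> = fst q $ i * z $ i + (\<Sum>l\<in>UNIV - {i}. fst q $ l * z $ l)"
          by (rule sum.remove) auto
        finally have "fst q $ i * z $ i = fst q \<bullet> z - (\<Sum>l\<in>UNIV - {i}. fst q $ l * z $ l)"
          by simp
        moreover have "fst q \<bullet> z = q \<bullet> (x, 1) - q \<bullet> (y, 1)"
          by (simp add: z_def inner_prod_def inner_diff_right)
        moreover have "\<bar>\<Sum>l\<in>UNIV - {i}. fst q $ l * z $ l\<bar> \<le> real ?n * (\<bar>fst q $ i\<bar> * (1 / real M))"
        proof -
          have "\<bar>\<Sum>l\<in>UNIV - {i}. fst q $ l * z $ l\<bar> \<le> (\<Sum>l\<in>UNIV - {i}. \<bar>fst q $ l * z $ l\<bar>)"
            by (rule sum_abs)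
          also have "\<dots> \<le> (\<Sum>l\<in>UNIV - {i}. \<bar>fst q $ i\<bar> * (1 / real M))"
            unfolding abs_mult
            by (intro sum_mono mult_mono) (use other component_le_infnorm_cart[of "fst q"] i in auto)
          also have "\<dots> \<le> (\<Sum>l\<in>(UNIV :: 'n set). \<bar>fst q $ i\<bar> * (1 / real M))"
            by (intro sum_mono2) auto
          finally show ?thesis by simp
        qed
        ultimately have "\<bar>fst q $ i * z $ i\<bar> \<le> 2 * w + real ?n * (\<bar>fst q $ i\<bar> * (1 / real M))"
          using xy by linarith
        also have "\<dots> \<le> 2 * (\<bar>fst q $ i\<bar> * (1 / real M)) + real ?n * (\<bar>fst q $ i\<bar> * (1 / real M))"
          using w i M by (simp add: field_simps)
        finally have "\<bar>fst q $ i\<bar> * \<bar>z $ i\<bar> \<le> \<bar>fst q $ i\<bar> * ((real ?n + 2) / real M)"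
          by (simp add: abs_mult algebra_simps add_divide_distrib)
        then show ?thesis by (rule mult_left_le_imp_le) (use q i in simp)
      qed
      have "\<bar>z $ l\<bar> \<le> (real ?n + 2) / real M" for l
        using zi other[of l] M by (cases "l = i") (auto simp: field_simps)
      \<comment> \<open>The Euclidean norm is bounded through the sum of the coordinates, which
        costs the further factor \<open>n\<close>.\<close>
      then have "(\<Sum>l\<in>UNIV. \<bar>z $ l\<bar>) \<le> real ?n * ((real ?n + 2) / real M)"
        using sum_bounded_above[of UNIV "\<lambda>l. \<bar>z $ l\<bar>" "(real ?n + 2) / real M"] by simp
      then show ?thesis using norm_le_l1_cart[of z] by (simp add: z_def)
    qed
    then show "diameter U \<le> real ?n * (real ?n + 2) / real M"
      by (intro diameter_le) auto
    show "bounded U"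
      unfolding bounded_two_points using dist by (auto simp: dist_norm)
  qed
  ultimately show ?thesis using card \<open>finite G\<close> by blast
qed

section \<open>The limsup set of a single subspace\<close>

text \<open>The last coordinate of \<open>q\<close> is nearly \<open>- (fst q \<bullet> x)\<close>,
  since \<open>q \<bullet> (x, 1)\<close> is small; in a fixed box the norm is thus comparable to
  the height. This lets the count by norm be used for best approximations of given height.\<close>

lemma best_approximation_norm_le:
  fixes x :: "real ^ 'n::finite"
  assumes "best_approximation x q" "infnorm x \<le> real m"
  shows "norm q \<le> (real CARD('n) * (real m + 1) + 1) * infnorm (fst q)"
proof -
  let ?I = "infnorm (fst q)"
  note q = best_approximation_bound[OF assms(1)]
  have "norm (fst q) \<le> (\<Sum>l\<in>UNIV. \<bar>fst q $ l\<bar>)" by (rule norm_le_l1_cart)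
  also have "\<dots> \<le> real CARD('n) * ?I"
    using sum_bounded_above[of UNIV "\<lambda>l. \<bar>fst q $ l\<bar>" ?I] component_le_infnorm_cart[of "fst q"]
    by simp
  finally have 1: "norm (fst q) \<le> real CARD('n) * ?I" .
  have "\<bar>fst q \<bullet> x\<bar> \<le> (\<Sum>l\<in>UNIV. \<bar>fst q $ l * x $ l\<bar>)"
    by (simp add: inner_vec_def sum_abs)
  also have "\<dots> \<le> real CARD('n) * (?I * real m)"
  proof -
    have "\<bar>fst q $ l * x $ l\<bar> \<le> ?I * real m" for l
      using component_le_infnorm_cart[of "fst q" l] component_le_infnorm_cart[of x l] assms(2)
      unfolding abs_mult by (intro mult_mono) (auto simp: infnorm_pos_le)
    then show ?thesis using sum_bounded_above[of UNIV "\<lambda>l. \<bar>fst q $ l * x $ l\<bar>"] by simp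
  qed
  finally have 2: "\<bar>fst q \<bullet> x\<bar> \<le> real CARD('n) * (?I * real m)" .
  \<comment> \<open>Since the height is at least 1, the Dirichlet bound is at most
    \<open>?I\<close>, which keeps the estimate linear in \<open>?I\<close>.\<close>
  have "1 / ?I ^ CARD('n) \<le> 1" using q(2) by (simp add: one_le_power)
  then have "\<bar>q \<bullet> (x, 1)\<bar> \<le> ?I" using q by linarith
  then have "\<bar>snd q\<bar> \<le> ?I + real CARD('n) * (?I * real m)"
    using 2 by (simp add: inner_prod_def)
  moreover have "norm q \<le> norm (fst q) + \<bar>snd q\<bar>"
    using norm_Pair_le[of "fst q" "snd q"] by simp
  ultimately show ?thesis using 1 by (simp add: algebra_simps)
qed

lemma hausdorff_measure_subspace_null:
  fixes V :: "((real ^ 'n::finite) \<times> real) set" and m :: nat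
  assumes V: "subspace V" "dim V = k"
    and s: "real CARD('n) - 1 + real k / (real CARD('n) + 1) < s"
  shows "hausdorff_measure s
      {x :: real ^ 'n. infnorm x \<le> real m \<and> infinite {q \<in> V. best_approximation x q}} = 0"
proof -
  let ?n = "CARD('n)"
  have n: "?n \<ge> 1" by (simp add: Suc_leI)
  \<comment> \<open>\<open>K\<close> is the constant of
    \<open>best_approximation_norm_le\<close>.\<close>
  define K where "K = real ?n * (real m + 1) + 1"
  have K: "K \<ge> 1" by (simp add: K_def)
  \<comment> \<open>The upper bound is on the norm, as the counting lemma requires. The levels may
    overlap; what matters is their size and that every best approximation in \<open>V\<close> for a
    point of the box lies in one of them.\<close>
  define S where "S = (\<lambda>j. {q \<in> V \<inter> integer_points. norm q \<le> K * 2 ^ (j + 1) \<and> 2 ^ j \<le> infnorm (fst q)})"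
  \<comment> \<open>With \<open>w = 1 / 2 ^ (n * j)\<close>, Dirichlet's bound at height
    \<open>2 ^ j\<close>, this choice makes \<open>w * real M\<close> equal to \<open>2 ^ j\<close>,
    the lower height bound in \<open>S j\<close>, as \<open>strip_cover\<close> needs.\<close>
  define M where "M = (\<lambda>j. (2::nat) ^ ((?n + 1) * j))"
  define strip where "strip = (\<lambda>j (q :: (real ^ 'n) \<times> real). {x :: real ^ 'n. infnorm x \<le> real m \<and> \<bar>q \<bullet> (x, 1)\<bar> \<le> 1 / 2 ^ (?n * j)})"
  define P where "P = (\<lambda>j q F. finite F \<and> real (card F) \<le> (real (2 * m + 1) * real (M j)) ^ (?n - 1) \<and>
      strip j q \<subseteq> \<Union>F \<and>
      (\<forall>U\<in>F. bounded U \<and> diameter U \<le> real ?n * (real ?n + 2) / real (M j)))"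
  have ex: "\<exists>F. P j q F" if "q \<in> S j" for j q
  proof -
    have "1 / 2 ^ (?n * j) * real (M j) = 2 ^ j"
      by (simp add: M_def power_add field_simps)
    moreover have "2 ^ j \<le> infnorm (fst q)" using that by (simp add: S_def)
    moreover from this have "0 < infnorm (fst q)"
      by (rule less_le_trans[rotated]) simp
    ultimately show ?thesis
      unfolding P_def strip_def by (intro strip_cover) (simp_all add: M_def)
  qed
  define E where "E = (\<lambda>j q. SOME F. P j q F)"
  have E: "P j q (E j q)" if "q \<in> S j" for j q
    unfolding E_def using ex[OF that] by (rule someI_ex)
  define F where "F = (\<lambda>j. \<Union>q\<in>S j. E j q)"
  have R: "1 \<le> K * 2 ^ (j + 1)" for j :: nat
    using mult_mono[OF K one_le_power[of "2::real" "j + 1"]] K by simp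
  have sub: "S j \<subseteq> {q \<in> V \<inter> integer_points. norm q \<le> K * 2 ^ (j + 1)}" for j
    by (auto simp: S_def)
  have finS: "finite (S j)" for j
    using card_integer_points_subspace(1)[OF V R] sub finite_subset by blast
  have cardS: "real (card (S j)) \<le> ((2 * real k + 3) * (K * 2 ^ (j + 1))) ^ k" for j
    using card_integer_points_subspace[OF V R, of j] card_mono[OF _ sub, of j] by linarith
  define C where "C = ((2 * real k + 3) * (K * 2)) ^ k * real (2 * m + 1) ^ (?n - 1)"
  \<comment> \<open>Growth per level: \<open>2 ^ k\<close> from the points of \<open>S j\<close>,
    the other factor from the cells of each strip. \<open>C\<close> collects what does not depend on
    \<open>j\<close>.\<close>
  define N :: real where "N = 2 ^ k * (2 ^ (?n + 1)) ^ (?n - 1)"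
  show ?thesis
  proof (rule hausdorff_measure_limsup_null[where F = F and C = C and N = N
        and D = "real ?n * (real ?n + 2)" and \<rho> = "1 / 2 ^ (?n + 1)"])
    show "finite (F j)" for j
      using E finS by (auto simp: F_def P_def)
    show "real (card (F j)) \<le> C * N ^ j" for j
    proof -
      have "card (F j) \<le> (\<Sum>q\<in>S j. card (E j q))"
        unfolding F_def by (rule card_UN_le[OF finS])
      then have "real (card (F j)) \<le> (\<Sum>q\<in>S j. real (card (E j q)))"
        by (metis of_nat_le_iff of_nat_sum)
      also have "\<dots> \<le> real (card (S j)) * (real (2 * m + 1) * real (M j)) ^ (?n - 1)"
        using E by (intro sum_bounded_above) (auto simp: P_def)
      also have "\<dots> \<le> ((2 * real k + 3) * (K * 2 ^ (j + 1))) ^ k *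
          (real (2 * m + 1) * real (M j)) ^ (?n - 1)"
        by (intro mult_right_mono cardS) simp
      also have "\<dots> = C * N ^ j"
      proof -
        have "((2 * real k + 3) * (K * 2 ^ (j + 1))) ^ k = ((2 * real k + 3) * (K * 2)) ^ k * (2 ^ k) ^ j"
        proof -
          have "(2 * real k + 3) * (K * 2 ^ (j + 1)) = (2 * real k + 3) * (K * 2) * 2 ^ j" by simp
          then show ?thesis
            by (simp only: power_mult_distrib power_mult[symmetric] mult.commute[of j k])
        qed
        moreover have "real (M j) ^ (?n - 1) = ((2 ^ (?n + 1)) ^ (?n - 1)) ^ j"
          unfolding M_def of_nat_power of_nat_numeral power_mult[symmetric] by (simp only: mult_ac)
        ultimately show ?thesis
          unfolding C_def N_def power_mult_distrib[of "real (2 * m + 1)"]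
          by (simp only: power_mult_distrib mult_ac)
      qed
      finally show ?thesis .
    qed
    show "bounded U" if "U \<in> F j" for j U
      using that E by (auto simp: F_def P_def)
    show "diameter U \<le> real ?n * (real ?n + 2) * (1 / 2 ^ (?n + 1)) ^ j" if "U \<in> F j" for j U
    proof -
      have "diameter U \<le> real ?n * (real ?n + 2) / real (M j)"
        using that E by (auto simp: F_def P_def)
      also have "\<dots> = real ?n * (real ?n + 2) * (1 / 2 ^ (?n + 1)) ^ j"
        unfolding M_def of_nat_power of_nat_numeral power_mult by (simp add: power_divide)
      finally show ?thesis .
    qed
    show "infinite {j. x \<in> \<Union> (F j)}"
      if x: "x \<in> {x. infnorm x \<le> real m \<and> infinite {q \<in> V. best_approximation x q}}" for x
    \<comment> \<open>If \<open>x\<close> were met at finitely many levels only, its best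
      approximations in \<open>V\<close> would lie in finitely many of the finite sets
      \<open>S j\<close>.\<close>
    proof
      assume fin: "finite {j. x \<in> \<Union> (F j)}"
      have "{q \<in> V. best_approximation x q} \<subseteq> (\<Union>j\<in>{j. x \<in> \<Union> (F j)}. S j)"
      proof
        fix q assume "q \<in> {q \<in> V. best_approximation x q}"
        then have q: "q \<in> V" "best_approximation x q" by auto
        note b = best_approximation_bound[OF q(2)]
        obtain Q where Q: "infnorm (fst q) = real Q" by (rule infnorm_integer_point[OF b(1)])
        then have "1 \<le> Q" using b(2) by simp
        then obtain j where j: "2 ^ j \<le> Q" "Q < 2 ^ (j + 1)"
          using ex_power_ivl1[of 2 Q] by auto
        have low: "2 ^ j \<le> infnorm (fst q)" using j(1) Q
          by (metis of_nat_le_iff of_nat_numeral of_nat_power)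
        have "real Q \<le> 2 ^ (j + 1)" using j(2)
          by (metis less_imp_le of_nat_le_iff of_nat_numeral of_nat_power)
        have "norm q \<le> K * infnorm (fst q)"
          unfolding K_def using x q by (intro best_approximation_norm_le) auto
        also have "\<dots> \<le> K * 2 ^ (j + 1)"
          using \<open>real Q \<le> 2 ^ (j + 1)\<close> Q K by (intro mult_left_mono) auto
        finally have "q \<in> S j" using q b low by (auto simp: S_def)
        have "(2::real) ^ (?n * j) \<le> infnorm (fst q) ^ ?n"
          using power_mono[OF low, of ?n] by (simp add: mult.commute flip: power_mult)
        then have "1 / infnorm (fst q) ^ ?n \<le> 1 / 2 ^ (?n * j)"
          by (intro divide_left_mono mult_pos_pos zero_less_power) (use b in auto)
        then have "x \<in> strip j q" using b x by (auto simp: strip_def)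
        then have "x \<in> \<Union> (F j)" using E[OF \<open>q \<in> S j\<close>] \<open>q \<in> S j\<close>
          unfolding F_def P_def by blast
        then show "q \<in> (\<Union>j\<in>{j. x \<in> \<Union> (F j)}. S j)" using \<open>q \<in> S j\<close> by blast
      qed
      then have "finite {q \<in> V. best_approximation x q}"
        using fin finS by (meson finite_UN_I finite_subset)
      then show False using x by simp
    qed
    show "s > 0"
    proof -
      have "0 \<le> real ?n - 1 + real k / (real ?n + 1)" using n by simp
      then show ?thesis using s by linarith
    qed
    \<comment> \<open>Comparing exponents of 2, the claim becomes
      \<open>k + (n + 1) * (n - 1) < (n + 1) * s\<close>, which is the hypothesis on
      \<open>s\<close> multiplied by \<open>n + 1\<close>.\<close>
    show "N * (1 / 2 ^ (?n + 1)) powr s < 1"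
    proof -
      have "N = 2 powr (real k + (real ?n + 1) * (real ?n - 1))"
      proof -
        have "N = 2 ^ (k + (?n + 1) * (?n - 1))"
          by (simp only: N_def power_mult[symmetric] power_add[symmetric])
        also have "\<dots> = 2 powr real (k + (?n + 1) * (?n - 1))"
          by (rule powr_realpow[symmetric]) simp
        also have "real (k + (?n + 1) * (?n - 1)) = real k + (real ?n + 1) * (real ?n - 1)"
          by (simp only: of_nat_add of_nat_mult of_nat_1 of_nat_diff[OF n])
        finally show ?thesis .
      qed
      moreover have "1 / 2 ^ (?n + 1) = (2::real) powr (- (real ?n + 1))"
      proof -
        have "real ?n + 1 = real (?n + 1)" by simp
        then show ?thesis by (simp only: powr_minus_divide powr_realpow zero_less_numeral)
      qed
      moreover have "real k + (real ?n + 1) * (real ?n - 1) < (real ?n + 1) * s"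
      proof -
        have "(real ?n + 1) * (real ?n - 1 + real k / (real ?n + 1)) < (real ?n + 1) * s"
          using s by (intro mult_strict_left_mono) auto
        moreover have "(real ?n + 1) * (real ?n - 1 + real k / (real ?n + 1))
            = real k + (real ?n + 1) * (real ?n - 1)"
          by (simp add: distrib_left)
        ultimately show ?thesis by simp
      qed
      ultimately show ?thesis
        by (simp add: powr_powr powr_less_one algebra_simps flip: powr_add)
    qed
    show "1 / 2 ^ (?n + 1) < (1 :: real)"
      using one_less_power[of "2 :: real" "?n + 1"] by simp
  qed (simp_all add: N_def)
qed

section \<open>Countable union over subspaces and boxes\<close>

text \<open>Replacing a sublattice by its span only adds points and keeps the dimension. Requiring
  \<open>V\<close> to be the span of a finite set of integer points makes the family of subspaces
  countable, and the boxes of size \<open>m\<close> exhaust the space.\<close>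

lemma Y_set_subset:
  "(Y_set k :: (real ^ 'n::finite) set) \<subseteq>
    (\<Union>(V, m)\<in>{V. subspace V \<and> dim V = k \<and> V \<in> span ` {B. finite B \<and> B \<subseteq> integer_points}} \<times> UNIV.
      {x. infnorm x \<le> real (m :: nat) \<and> infinite {q \<in> V. best_approximation x q}})"
proof
  fix x :: "real ^ 'n"
  assume "x \<in> Y_set k"
  then obtain \<L> where L: "finite \<L>" "\<forall>L\<in>\<L>. sublattice k L"
      "infinite {q \<in> \<Union>\<L>. best_approximation x q}"
    by (auto simp: Y_set_def)
  have "{q \<in> \<Union>\<L>. best_approximation x q} = (\<Union>L\<in>\<L>. {q \<in> L. best_approximation x q})" by blast
  then obtain L where "L \<in> \<L>" and inf: "infinite {q \<in> L. best_approximation x q}"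
    using L by auto
  then have L': "L \<subseteq> integer_points" "dim L = k" using L by (auto simp: sublattice_def)
  obtain B where B: "B \<subseteq> L" "independent B" "L \<subseteq> span B" by (rule basis_exists)
  then have "span L = span B" by (metis span_eq span_superset subset_trans)
  then have "span L \<in> span ` {B. finite B \<and> B \<subseteq> integer_points}"
    using B L' independent_imp_finite by blast
  moreover have "infinite {q \<in> span L. best_approximation x q}"
    using inf by (rule contrapos_nn) (erule finite_subset[rotated], auto intro: span_base)
  moreover obtain m :: nat where "infnorm x \<le> real m" using real_arch_simple by blast
  ultimately show "x \<in> (\<Union>(V, m)\<in>{V. subspace V \<and> dim V = k \<and>
        V \<in> span ` {B. finite B \<and> B \<subseteq> integer_points}} \<times> UNIV.
      {x. infnorm x \<le> real (m :: nat) \<and> infinite {q \<in> V. best_approximation x q}})"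
    using L' by (intro UN_I[of "(span L, m)"]) (auto simp: dim_span)
qed

theorem theorem6:
  fixes k :: nat
  assumes "2 \<le> k" and "k \<le> CARD('n::finite)"
  shows "hausdorff_dim (Y_set k :: (real ^ 'n) set)
           \<le> ereal (real CARD('n) - 1 + real k / (real CARD('n) + 1))"
proof (rule ereal_le_epsilon2)
  fix e :: real
  assume "e > 0"
  let ?b = "real CARD('n) - 1 + real k / (real CARD('n) + 1)"
  define s where "s = ?b + e"
  have "?b < s" using \<open>e > 0\<close> by (simp add: s_def)
  \<comment> \<open>\<open>hausdorff_dim\<close> takes the infimum over nonnegative exponents
    only.\<close>
  moreover have "0 \<le> ?b" by (simp add: Suc_leI)
  ultimately have "0 \<le> s" by linarith
  let ?I = "{V :: ((real ^ 'n) \<times> real) set. subspace V \<and> dim V = k \<and>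
      V \<in> span ` {B. finite B \<and> B \<subseteq> integer_points}} \<times> (UNIV :: nat set)"
  have "countable (span ` {B :: ((real ^ 'n) \<times> real) set. finite B \<and> B \<subseteq> integer_points})"
    by (intro countable_image countable_Collect_finite_subset countable_integer_points)
  then have "countable {V :: ((real ^ 'n) \<times> real) set. subspace V \<and> dim V = k \<and>
      V \<in> span ` {B. finite B \<and> B \<subseteq> integer_points}}"
    by (rule countable_subset[rotated]) blast
  then have "countable ?I" by (intro countable_SIGMA) auto
  then have null: "hausdorff_measure s (\<Union>(V, m)\<in>?I.
      {x :: real ^ 'n. infnorm x \<le> real m \<and> infinite {q \<in> V. best_approximation x q}}) = 0"
    by (rule hausdorff_measure_countable_UN_null)
      (use \<open>?b < s\<close> in \<open>auto intro: hausdorff_measure_subspace_null\<close>)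
  have "hausdorff_measure s (Y_set k :: (real ^ 'n) set) \<le> 0"
    \<comment> \<open>The bound 0 is rewritten as the measure of the null union, so that
      monotonicity applies.\<close>
    unfolding null[symmetric] by (rule hausdorff_measure_mono[OF Y_set_subset])
  then have "hausdorff_dim (Y_set k :: (real ^ 'n) set) \<le> ereal s"
    unfolding hausdorff_dim_def using \<open>0 \<le> s\<close> by (intro INF_lower) auto
  then show "hausdorff_dim (Y_set k :: (real ^ 'n) set) \<le> ereal ?b + ereal e"
    by (simp add: s_def)
qed

end
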